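(* Let $\mathbf K$ be the $(S,\Sigma)$-polyadic normal modal logic described in the context. For every sort $s\in S$, every formula $\phi\in Form_s$ and every set $\Phi_s\subseteq Form_s$, $$\Phi_s\vdash^s_{\mathbf K}\phi \quad\text{if and only if}\quad \Phi_s\models^s\phi,$$ where $\Phi_s\models^s\phi$ is local semantic consequence over the class of all $(S,\Sigma)$-frames.
   Context: Let $(S,\Sigma)$ be a many-sorted signature: $S$ is a set of sorts and each operation symbol $\sigma\in\Sigma$ has a type $s_1\ldots s_n\to s$ ($n\geq 0$); $\Sigma_{s_1\ldots s_n,s}$ denotes the symbols of that type. Let $P=\{P_s\}_{s\in S}$ be nonempty, pairwise disjoint sets of propositional variables. Formulas $Form=\{Form_s\}_{s\in S}$: $P_s\subseteq Form_s$; if $\phi,\psi\in Form_s$ then $\neg\phi,\phi\vee\psi\in Form_s$; if $\sigma\in\Sigma_{s_1\ldots s_n,s}$ and $\phi_i\in Form_{s_i}$ then $\sigma(\phi_1,\ldots,\phi_n)\in Form_s$. Abbreviations: $\wedge,\to,\leftrightarrow$ as usual, $\bot_s:=p\wedge\neg p$ for a fixed $p\in P_s$, $\top_s:=\neg\bot_s$, and for $n\geq1$, $\sigma^{\Box}(\phi_1,\ldots,\phi_n):=\neg\sigma(\neg\phi_1,\ldots,\neg\phi_n)$; $[n]=\{1,\ldots,n\}$. $\mathbf K=\{\mathbf K_s\}_{s\in S}$ is the least $S$-sorted set of formulas such that $\mathbf K_s$ contains every formula of $Form_s$ which is a theorem of classical propositional logic, and, for all $n\ge1$, $\sigma\in\Sigma_{s_1\ldots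 s_n,s}$, $i\in[n]$, $\psi_j\in Form_{s_j}$, $\phi,\chi\in Form_{s_i}$, the formulas $\sigma^\Box(\psi_1,\ldots,\phi\to\chi,\ldots,\psi_n)\to(\sigma^\Box(\psi_1,\ldots,\phi,\ldots,\psi_n)\to\sigma^\Box(\psi_1,\ldots,\chi,\ldots,\psi_n))$ (displayed arguments in position $i$) and $\sigma(\psi_1,\ldots,\psi_n)\leftrightarrow\neg\sigma^\Box(\neg\psi_1,\ldots,\neg\psi_n)$. Inference rules: modus ponens within a sort, and universal generalization: from $\phi\in Form_{s_i}$ infer $\sigma^\Box(\psi_1,\ldots,\psi_{i-1},\phi,\psi_{i+1},\ldots,\psi_n)$ for any $\sigma\in\Sigma_{s_1\ldots s_n,s}$ with $n\ge1$, $i\in[n]$, $\psi_j\in Form_{s_j}$. $\vdash^s_{\mathbf K}\phi$ means $\phi\in Form_s$ is the last element of a finite sequence of formulas each of which is in $\mathbf K$ or obtained from earlier ones by the rules. $\Phi_s\vdash^s_{\mathbf K}\phi$ means there are $\phi_1,\ldots,\phi_n\in\Phi_s$ with $\vdash^s_{\mathbf K}(\phi_1\wedge\cdots\wedge\phi_n)\to\phi$. An $(S,\Sigma)$-frame is $(\{W_s\}_{s\in S},\{R_\sigma\}_{\sigma\in\Sigma})$ with $W_s\neq\emptyset$ and $R_\sigma\subseteq W_s\times W_{s_1}\times\cdots\times W_{s_n}$ for $\sigma\in\Sigma_{s_1\ldots s_n,s}$; a model adds valuations $\rho_s:P_s\to\mathcal P(W_s)$. Satisfaction $\mathcal M,w\models^s\phi$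 ($w\in W_s$): $w\in\rho_s(p)$ for variables, classical clauses for $\neg,\vee$, and $\mathcal M,w\models^s\sigma(\phi_1,\ldots,\phi_n)$ iff there are $w_i\in W_{s_i}$ with $R_\sigma ww_1\ldots w_n$ and $\mathcal M,w_i\models^{s_i}\phi_i$ for all $i$. $\Phi_s\models^s\phi$ means: for every model $\mathcal M$ and $w\in W_s$, if $\mathcal M,w\models^s\psi$ for all $\psi\in\Phi_s$ then $\mathcal M,w\models^s\phi$. *)

theory Defs
  imports Main
begin

section \<open>Many-sorted signatures and formulas\<close>

text \<open>An operation symbol of type \<open>s\<^sub>1 \<dots> s\<^sub>n \<rightarrow> s\<close> has \<open>args = [s\<^sub>1, \<dots>, s\<^sub>n]\<close> and \<open>res = s\<close>.\<close>

record ('s, 'o, 'p) language =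
  sorts :: "'s set"
  ops :: "'o set"
  args :: "'o \<Rightarrow> 's list"
  res :: "'o \<Rightarrow> 's"
  vars :: "'s \<Rightarrow> 'p set"

definition many_sorted_language :: "('s, 'o, 'p) language \<Rightarrow> bool" where
  "many_sorted_language L \<longleftrightarrow>
     (\<forall>\<sigma>\<in>ops L. set (args L \<sigma>) \<subseteq> sorts L \<and> res L \<sigma> \<in> sorts L) \<and>
     (\<forall>s\<in>sorts L. vars L s \<noteq> {}) \<and>
     (\<forall>s\<in>sorts L. \<forall>t\<in>sorts L. s \<noteq> t \<longrightarrow> vars L s \<inter> vars L t = {})"

datatype ('o, 'p) fm =
    Var 'p
  | Neg "('o, 'p) fm"
  | Or "('o, 'p) fm" "('o, 'p) fm"
  | Op 'o "('o, 'p) fm list"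

inductive has_sort :: "('s, 'o, 'p) language \<Rightarrow> 's \<Rightarrow> ('o, 'p) fm \<Rightarrow> bool"
  for L :: "('s, 'o, 'p) language" where
  Var: "s \<in> sorts L \<Longrightarrow> p \<in> vars L s \<Longrightarrow> has_sort L s (Var p)"
| Neg: "has_sort L s \<phi> \<Longrightarrow> has_sort L s (Neg \<phi>)"
| Or: "has_sort L s \<phi> \<Longrightarrow> has_sort L s \<psi> \<Longrightarrow> has_sort L s (Or \<phi> \<psi>)"
| Op: "\<sigma> \<in> ops L \<Longrightarrow> list_all2 (has_sort L) (args L \<sigma>) \<phi>s \<Longrightarrow> has_sort L (res L \<sigma>) (Op \<sigma> \<phi>s)"

definition Form :: "('s, 'o, 'p) language \<Rightarrow> 's \<Rightarrow> ('o, 'p) fm set" where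
  "Form L s = {\<phi>. has_sort L s \<phi>}"

abbreviation And :: "('o, 'p) fm \<Rightarrow> ('o, 'p) fm \<Rightarrow> ('o, 'p) fm" where
  "And \<phi> \<psi> \<equiv> Neg (Or (Neg \<phi>) (Neg \<psi>))"

abbreviation Imp :: "('o, 'p) fm \<Rightarrow> ('o, 'p) fm \<Rightarrow> ('o, 'p) fm" where
  "Imp \<phi> \<psi> \<equiv> Or (Neg \<phi>) \<psi>"

abbreviation Iff :: "('o, 'p) fm \<Rightarrow> ('o, 'p) fm \<Rightarrow> ('o, 'p) fm" where
  "Iff \<phi> \<psi> \<equiv> And (Imp \<phi> \<psi>) (Imp \<psi> \<phi>)"

definition Bot :: "('s, 'o, 'p) language \<Rightarrow> 's \<Rightarrow> ('o, 'p) fm" where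
  "Bot L s = (let p = Var (SOME p. p \<in> vars L s) in And p (Neg p))"

definition Top :: "('s, 'o, 'p) language \<Rightarrow> 's \<Rightarrow> ('o, 'p) fm" where
  "Top L s = Neg (Bot L s)"

abbreviation Box :: "'o \<Rightarrow> ('o, 'p) fm list \<Rightarrow> ('o, 'p) fm" where
  "Box \<sigma> \<phi>s \<equiv> Neg (Op \<sigma> (map Neg \<phi>s))"

fun Conj :: "('s, 'o, 'p) language \<Rightarrow> 's \<Rightarrow> ('o, 'p) fm list \<Rightarrow> ('o, 'p) fm" where
  "Conj L s [] = Top L s"
| "Conj L s [\<phi>] = \<phi>"
| "Conj L s (\<phi> # \<psi> # \<chi>s) = And \<phi> (Conj L s (\<psi> # \<chi>s))"


section \<open>The deductive system\<close>

text \<open>Theorems of classical propositional logic among the formulas of sort \<open>s\<close>, where variables and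
  formulas \<open>\<sigma>(\<phi>\<^sub>1, \<dots>, \<phi>\<^sub>n)\<close> play the role of atoms. The calculus is that of Hilbert and
  Ackermann, whose primitive connectives are \<open>\<not>\<close> and \<open>\<or>\<close>; \<open>cpl_iff_tautology\<close> below shows that it
  proves exactly the tautologies.\<close>

inductive cpl :: "('s, 'o, 'p) language \<Rightarrow> 's \<Rightarrow> ('o, 'p) fm \<Rightarrow> bool"
  for L :: "('s, 'o, 'p) language" and s :: 's where
  Idem: "\<phi> \<in> Form L s \<Longrightarrow> cpl L s (Imp (Or \<phi> \<phi>) \<phi>)"
| Add: "\<phi> \<in> Form L s \<Longrightarrow> \<psi> \<in> Form L s \<Longrightarrow> cpl L s (Imp \<phi> (Or \<phi> \<psi>))"
| Perm: "\<phi> \<in> Form L s \<Longrightarrow> \<psi> \<in> Form L s \<Longrightarrow> cpl L s (Imp (Or \<phi> \<psi>) (Or \<psi> \<phi>))"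
| Sum: "\<phi> \<in> Form L s \<Longrightarrow> \<psi> \<in> Form L s \<Longrightarrow> \<chi> \<in> Form L s \<Longrightarrow>
    cpl L s (Imp (Imp \<psi> \<chi>) (Imp (Or \<phi> \<psi>) (Or \<phi> \<chi>)))"
| MP: "cpl L s (Imp \<phi> \<psi>) \<Longrightarrow> cpl L s \<phi> \<Longrightarrow> cpl L s \<psi>"

inductive axiom_K :: "('s, 'o, 'p) language \<Rightarrow> 's \<Rightarrow> ('o, 'p) fm \<Rightarrow> bool"
  for L :: "('s, 'o, 'p) language" where
  Prop: "s \<in> sorts L \<Longrightarrow> cpl L s \<phi> \<Longrightarrow> axiom_K L s \<phi>"
| Distr: "\<sigma> \<in> ops L \<Longrightarrow> i < length (args L \<sigma>) \<Longrightarrow>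
    list_all2 (\<lambda>t \<psi>. \<psi> \<in> Form L t) (args L \<sigma>) \<psi>s \<Longrightarrow>
    \<phi> \<in> Form L (args L \<sigma> ! i) \<Longrightarrow> \<chi> \<in> Form L (args L \<sigma> ! i) \<Longrightarrow>
    axiom_K L (res L \<sigma>)
      (Imp (Box \<sigma> (\<psi>s[i := Imp \<phi> \<chi>])) (Imp (Box \<sigma> (\<psi>s[i := \<phi>])) (Box \<sigma> (\<psi>s[i := \<chi>]))))"
| Dual: "\<sigma> \<in> ops L \<Longrightarrow> args L \<sigma> \<noteq> [] \<Longrightarrow>
    list_all2 (\<lambda>t \<psi>. \<psi> \<in> Form L t) (args L \<sigma>) \<psi>s \<Longrightarrow>
    axiom_K L (res L \<sigma>) (Iff (Op \<sigma> \<psi>s) (Neg (Box \<sigma> (map Neg \<psi>s))))"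

text \<open>One proof step from a set of already derived formulas, each paired with its sort.\<close>

inductive infer_K :: "('s, 'o, 'p) language \<Rightarrow> ('s \<times> ('o, 'p) fm) set \<Rightarrow> 's \<times> ('o, 'p) fm \<Rightarrow> bool"
  for L :: "('s, 'o, 'p) language" and X :: "('s \<times> ('o, 'p) fm) set" where
  Axiom: "axiom_K L s \<phi> \<Longrightarrow> infer_K L X (s, \<phi>)"
| MP: "(s, Imp \<phi> \<psi>) \<in> X \<Longrightarrow> (s, \<phi>) \<in> X \<Longrightarrow> infer_K L X (s, \<psi>)"
| UG: "\<sigma> \<in> ops L \<Longrightarrow> i < length (args L \<sigma>) \<Longrightarrow> (args L \<sigma> ! i, \<phi>) \<in> X \<Longrightarrow>
    list_all2 (\<lambda>t \<psi>. \<psi> \<in> Form L t) (args L \<sigma>) \<psi>s \<Longrightarrow>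
    infer_K L X (res L \<sigma>, Box \<sigma> (\<psi>s[i := \<phi>]))"

definition is_proof_K :: "('s, 'o, 'p) language \<Rightarrow> ('s \<times> ('o, 'p) fm) list \<Rightarrow> bool" where
  "is_proof_K L \<pi> \<longleftrightarrow> (\<forall>k < length \<pi>. infer_K L (set (take k \<pi>)) (\<pi> ! k))"

definition provable_K :: "('s, 'o, 'p) language \<Rightarrow> 's \<Rightarrow> ('o, 'p) fm \<Rightarrow> bool" where
  "provable_K L s \<phi> \<longleftrightarrow> (\<exists>\<pi>. \<pi> \<noteq> [] \<and> is_proof_K L \<pi> \<and> last \<pi> = (s, \<phi>))"

definition derivable_K :: "('s, 'o, 'p) language \<Rightarrow> 's \<Rightarrow> ('o, 'p) fm set \<Rightarrow> ('o, 'p) fm \<Rightarrow> bool" where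
  "derivable_K L s \<Phi> \<phi> \<longleftrightarrow> (\<exists>\<phi>s. set \<phi>s \<subseteq> \<Phi> \<and> provable_K L s (Imp (Conj L s \<phi>s) \<phi>))"


section \<open>Frames, models and local consequence\<close>

record ('s, 'o, 'w) frame =
  worlds :: "'s \<Rightarrow> 'w set"
  rel :: "'o \<Rightarrow> ('w \<times> 'w list) set"

record ('s, 'o, 'p, 'w) model = "('s, 'o, 'w) frame" +
  val :: "'s \<Rightarrow> 'p \<Rightarrow> 'w set"

definition is_frame :: "('s, 'o, 'p) language \<Rightarrow> ('s, 'o, 'w, 'm) frame_scheme \<Rightarrow> bool" where
  "is_frame L F \<longleftrightarrow>
     (\<forall>s\<in>sorts L. worlds F s \<noteq> {}) \<and>
     (\<forall>\<sigma>\<in>ops L. \<forall>(w, ws)\<in>rel F \<sigma>.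
        w \<in> worlds F (res L \<sigma>) \<and> list_all2 (\<lambda>u t. u \<in> worlds F t) ws (args L \<sigma>))"

definition is_model :: "('s, 'o, 'p) language \<Rightarrow> ('s, 'o, 'p, 'w) model \<Rightarrow> bool" where
  "is_model L M \<longleftrightarrow> is_frame L M \<and> (\<forall>s\<in>sorts L. \<forall>p\<in>vars L s. val M s p \<subseteq> worlds M s)"

function sat :: "('s, 'o, 'p) language \<Rightarrow> ('s, 'o, 'p, 'w) model \<Rightarrow> 's \<Rightarrow> 'w \<Rightarrow> ('o, 'p) fm \<Rightarrow> bool" where
  "sat L M s w (Var p) \<longleftrightarrow> w \<in> val M s p"
| "sat L M s w (Neg \<phi>) \<longleftrightarrow> \<not> sat L M s w \<phi>"
| "sat L M s w (Or \<phi> \<psi>) \<longleftrightarrow> sat L M s w \<phi> \<or> sat L M s w \<psi>"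
| "sat L M s w (Op \<sigma> \<phi>s) \<longleftrightarrow>
     (\<exists>ws. (w, ws) \<in> rel M \<sigma> \<and>
        (\<forall>i < length \<phi>s. ws ! i \<in> worlds M (args L \<sigma> ! i) \<and> sat L M (args L \<sigma> ! i) (ws ! i) (\<phi>s ! i)))"
  by pat_completeness auto
termination
  by (relation "measure (\<lambda>(L, M, s, w, \<phi>). size \<phi>)")
    (auto simp: less_Suc_eq_le intro!: size_list_estimation'[OF nth_mem])

text \<open>Consequence over all frames whose worlds are drawn from the type \<open>'w\<close>; HOL has no quantifier
  over types. The type of sets of formulas is large enough to be the universe of canonical models.\<close>

definition consequence ::
  "'w itself \<Rightarrow> ('s, 'o, 'p) language \<Rightarrow> 's \<Rightarrow> ('o, 'p) fm set \<Rightarrow> ('o, 'p) fm \<Rightarrow> bool" where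
  "consequence (_ :: 'w itself) L s \<Phi> \<phi> \<longleftrightarrow>
     (\<forall>M :: ('s, 'o, 'p, 'w) model. is_model L M \<longrightarrow>
        (\<forall>w\<in>worlds M s. (\<forall>\<psi>\<in>\<Phi>. sat L M s w \<psi>) \<longrightarrow> sat L M s w \<phi>))"


section \<open>Adequacy of the propositional calculus\<close>

fun eval :: "(('o, 'p) fm \<Rightarrow> bool) \<Rightarrow> ('o, 'p) fm \<Rightarrow> bool" where
  "eval v (Neg \<phi>) \<longleftrightarrow> \<not> eval v \<phi>"
| "eval v (Or \<phi> \<psi>) \<longleftrightarrow> eval v \<phi> \<or> eval v \<psi>"
| "eval v \<phi> \<longleftrightarrow> v \<phi>"

lemma Form_Neg [simp]: "Neg \<phi> \<in> Form L s \<longleftrightarrow> \<phi> \<in> Form L s"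
  by (auto simp: Form_def intro: has_sort.intros elim: has_sort.cases)

lemma Form_Or [simp]: "Or \<phi> \<psi> \<in> Form L s \<longleftrightarrow> \<phi> \<in> Form L s \<and> \<psi> \<in> Form L s"
  by (auto simp: Form_def intro: has_sort.intros elim: has_sort.cases)

lemma cpl_Form: "cpl L s \<phi> \<Longrightarrow> \<phi> \<in> Form L s"
  by (induction rule: cpl.induct) auto

lemma cpl_sound: "cpl L s \<phi> \<Longrightarrow> eval v \<phi>"
  by (induction rule: cpl.induct) auto

lemma cpl_trans:
  assumes "cpl L s (Imp \<phi> \<psi>)" "cpl L s (Imp \<psi> \<chi>)"
  shows "cpl L s (Imp \<phi> \<chi>)"
proof -
  have "\<phi> \<in> Form L s" "\<psi> \<in> Form L s" "\<chi> \<in> Form L s"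
    using assms[THEN cpl_Form] by auto
  then have "cpl L s (Imp (Imp \<psi> \<chi>) (Imp (Imp \<phi> \<psi>) (Imp \<phi> \<chi>)))"
    by (intro cpl.Sum) auto
  from cpl.MP[OF cpl.MP[OF this assms(2)] assms(1)] show ?thesis .
qed

lemma cpl_refl: "\<phi> \<in> Form L s \<Longrightarrow> cpl L s (Imp \<phi> \<phi>)"
  by (rule cpl_trans[OF cpl.Add cpl.Idem])

lemma cpl_Or1: "\<phi> \<in> Form L s \<Longrightarrow> \<psi> \<in> Form L s \<Longrightarrow> cpl L s (Imp \<phi> (Or \<phi> \<psi>))"
  by (rule cpl.Add)

lemma cpl_Or2: "\<phi> \<in> Form L s \<Longrightarrow> \<psi> \<in> Form L s \<Longrightarrow> cpl L s (Imp \<psi> (Or \<phi> \<psi>))"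
  by (rule cpl_trans[OF cpl.Add cpl.Perm])

lemma cpl_swap:
  assumes "cpl L s (Or \<phi> \<psi>)"
  shows "cpl L s (Or \<psi> \<phi>)"
  using cpl.MP[OF cpl.Perm assms] cpl_Form[OF assms] by simp

lemma cpl_join:
  assumes "cpl L s (Imp \<phi> \<chi>)" "cpl L s (Imp \<psi> \<chi>)"
  shows "cpl L s (Imp (Or \<phi> \<psi>) \<chi>)"
proof -
  have F: "\<phi> \<in> Form L s" "\<psi> \<in> Form L s" "\<chi> \<in> Form L s"
    using assms[THEN cpl_Form] by auto
  have "cpl L s (Imp (Or \<phi> \<psi>) (Or \<phi> \<chi>))"
    by (rule cpl.MP[OF cpl.Sum assms(2)]) (fact F)+
  moreover have "cpl L s (Imp (Or \<phi> \<chi>) (Or \<chi> \<phi>))"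
    by (rule cpl.Perm) (fact F)+
  moreover have "cpl L s (Imp (Or \<chi> \<phi>) (Or \<chi> \<chi>))"
    by (rule cpl.MP[OF cpl.Sum assms(1)]) (fact F)+
  moreover have "cpl L s (Imp (Or \<chi> \<chi>) \<chi>)"
    by (rule cpl.Idem) (fact F)
  ultimately show ?thesis
    by (rule cpl_trans[OF _ cpl_trans[OF _ cpl_trans]])
qed

lemma cpl_cases:
  assumes "cpl L s (Imp \<phi> \<chi>)" "cpl L s (Imp (Neg \<phi>) \<chi>)"
  shows "cpl L s \<chi>"
proof -
  have "\<phi> \<in> Form L s"
    using cpl_Form[OF assms(1)] by simp
  then show ?thesis
    by (rule cpl.MP[OF cpl_join[OF assms(2,1)] cpl_refl])
qed

lemma cpl_NegNeg: "\<phi> \<in> Form L s \<Longrightarrow> cpl L s (Imp \<phi> (Neg (Neg \<phi>)))"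
  by (rule cpl_swap) (rule cpl_refl, simp)

lemma cpl_complete_list:
  assumes "set \<Gamma> \<subseteq> Form L s" "\<And>v. \<exists>\<phi>\<in>set \<Gamma>. eval v \<phi>"
    and "\<chi> \<in> Form L s" "\<And>\<phi>. \<phi> \<in> set \<Gamma> \<Longrightarrow> cpl L s (Imp \<phi> \<chi>)"
  shows "cpl L s \<chi>"
  using assms
proof (induction "sum_list (map size \<Gamma>)" arbitrary: \<Gamma> \<chi> rule: less_induct)
  case less
  show ?case
  proof (cases "\<exists>\<phi>\<in>set \<Gamma>. (\<exists>\<psi>. \<phi> = Neg (Neg \<psi>)) \<or> (\<exists>\<psi> \<psi>'. \<phi> = Or \<psi> \<psi>') \<or> (\<exists>\<psi> \<psi>'. \<phi> = Neg (Or \<psi> \<psi>'))")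
    case True
    then obtain \<phi> where \<phi>: "\<phi> \<in> set \<Gamma>"
      "(\<exists>\<psi>. \<phi> = Neg (Neg \<psi>)) \<or> (\<exists>\<psi> \<psi>'. \<phi> = Or \<psi> \<psi>') \<or> (\<exists>\<psi> \<psi>'. \<phi> = Neg (Or \<psi> \<psi>'))"
      by blast
    define \<Delta> where "\<Delta> = remove1 \<phi> \<Gamma>"
    have \<Gamma>: "set \<Gamma> = insert \<phi> (set \<Delta>)"
      using \<phi>(1) set_remove1_subset[of \<phi> \<Gamma>] by (auto simp: \<Delta>_def) (metis in_set_remove1)
    have sz: "sum_list (map size \<Gamma>) = size \<phi> + sum_list (map size \<Delta>)"
      using \<phi>(1) by (simp add: \<Delta>_def sum_list_map_remove1)
    have \<Delta>: "set \<Delta> \<subseteq> Form L s" and F: "\<phi> \<in> Form L s"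
      using less.prems(1) \<Gamma> by auto
    have \<Delta>\<chi>: "cpl L s (Imp \<delta> \<chi>)" if "\<delta> \<in> set \<Delta>" for \<delta>
      using less.prems(4) \<Gamma> that by auto
    have \<phi>\<chi>: "cpl L s (Imp \<phi> \<chi>)"
      using less.prems(4) \<Gamma> by auto
    consider (nn) \<psi> where "\<phi> = Neg (Neg \<psi>)" | (or) \<psi> \<psi>' where "\<phi> = Or \<psi> \<psi>'"
      | (nor) \<psi> \<psi>' where "\<phi> = Neg (Or \<psi> \<psi>')"
      using \<phi>(2) by blast
    then show ?thesis
    proof cases
      case nn
      have "cpl L s (Imp \<psi> \<chi>)"
        using cpl_trans[OF cpl_NegNeg \<phi>\<chi>[unfolded nn]] F nn by simp
      then show ?thesis
      proof (intro less.hyps[of "\<psi> # \<Delta>" \<chi>])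
        show "\<exists>\<delta>\<in>set (\<psi> # \<Delta>). eval v \<delta>" for v
          using less.prems(2)[of v] \<Gamma> nn by auto
      qed (use sz nn \<Delta> F \<Delta>\<chi> less.prems(3) in auto)
    next
      case or
      have "cpl L s (Imp \<psi> \<chi>)" "cpl L s (Imp \<psi>' \<chi>)"
        using cpl_trans[OF cpl_Or1 \<phi>\<chi>[unfolded or]] cpl_trans[OF cpl_Or2 \<phi>\<chi>[unfolded or]] F or by auto
      then show ?thesis
      proof (intro less.hyps[of "\<psi> # \<psi>' # \<Delta>" \<chi>])
        show "\<exists>\<delta>\<in>set (\<psi> # \<psi>' # \<Delta>). eval v \<delta>" for v
          using less.prems(2)[of v] \<Gamma> or by auto
      qed (use sz or \<Delta> F \<Delta>\<chi> less.prems(3) in auto)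
    next
      case nor
      have *: "cpl L s (Or \<chi> (Neg \<theta>))" if \<theta>: "\<theta> = \<psi> \<or> \<theta> = \<psi>'" for \<theta>
      proof (rule less.hyps[of "Neg \<theta> # \<Delta>"])
        have \<theta>F: "\<theta> \<in> Form L s"
          using F nor \<theta> by auto
        show "sum_list (map size (Neg \<theta> # \<Delta>)) < sum_list (map size \<Gamma>)"
          using sz nor \<theta> by auto
        show "set (Neg \<theta> # \<Delta>) \<subseteq> Form L s" "Or \<chi> (Neg \<theta>) \<in> Form L s"
          using \<theta>F \<Delta> less.prems(3) by auto
        show "\<exists>\<delta>\<in>set (Neg \<theta> # \<Delta>). eval v \<delta>" for v
          using less.prems(2)[of v] \<Gamma> nor \<theta> by auto
        show "cpl L s (Imp \<delta> (Or \<chi> (Neg \<theta>)))" if "\<delta> \<in> set (Neg \<theta> # \<Delta>)" for \<delta>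
          using that cpl_trans[OF \<Delta>\<chi> cpl_Or1] cpl_Or2[of \<chi> L s \<open>Neg \<theta>\<close>] \<theta>F less.prems(3) by auto
      qed
      have "cpl L s (Imp (Or \<psi> \<psi>') \<chi>)"
        by (rule cpl_join; rule cpl_swap; rule *) auto
      then show ?thesis
        using \<phi>\<chi> unfolding nor by (rule cpl_cases)
    qed
  next
    case False
    obtain \<phi> where \<phi>: "\<phi> \<in> set \<Gamma>" "eval (\<lambda>\<alpha>. Neg \<alpha> \<in> set \<Gamma>) \<phi>"
      using less.prems(2) by blast
    have "\<exists>\<alpha>. \<alpha> \<in> set \<Gamma> \<and> Neg \<alpha> \<in> set \<Gamma>"
    proof (cases \<phi>)
      case (Neg \<psi>)
      then show ?thesis
        using False \<phi> by (cases \<psi>) auto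
    qed (use False \<phi> in auto)
    then obtain \<alpha> where "\<alpha> \<in> set \<Gamma>" "Neg \<alpha> \<in> set \<Gamma>"
      by blast
    then show ?thesis
      by (rule cpl_cases[OF less.prems(4) less.prems(4)])
  qed
qed

theorem cpl_iff_tautology: "cpl L s \<phi> \<longleftrightarrow> \<phi> \<in> Form L s \<and> (\<forall>v. eval v \<phi>)"
proof
  assume "cpl L s \<phi>"
  then show "\<phi> \<in> Form L s \<and> (\<forall>v. eval v \<phi>)"
    by (simp add: cpl_Form cpl_sound)
next
  assume "\<phi> \<in> Form L s \<and> (\<forall>v. eval v \<phi>)"
  then show "cpl L s \<phi>"
    using cpl_complete_list[of "[\<phi>]" L s \<phi>] cpl_refl[of \<phi> L s] by auto
qed

end

theory Submission imports Defs begin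

text \<open>Soundness is an induction on proofs. For completeness, the worlds of the canonical model are
  the maximal consistent sets of each sort, and \<open>R\<^sub>\<sigma> w w\<^sub>1 \<dots> w\<^sub>n\<close> holds iff \<open>\<sigma>(\<psi>\<^sub>1, \<dots>, \<psi>\<^sub>n) \<in> w\<close>
  whenever all \<open>\<psi>\<^sub>i \<in> w\<^sub>i\<close>. The heart is the existence lemma: if \<open>\<sigma>(\<phi>\<^sub>1, \<dots>, \<phi>\<^sub>n) \<in> w\<close>, then suitable
  \<open>w\<^sub>i \<ni> \<phi>\<^sub>i\<close> exist. The singletons \<open>{\<phi>\<^sub>i}\<close> are enlarged to maximal consistent sets one position at a
  time. Given sets \<open>\<Gamma>\<^sub>j\<close> directed under provable implication, the formulas \<open>\<psi>\<close> with
  \<open>\<sigma>(\<psi>\<^sub>1, \<dots>, \<psi>, \<dots>, \<psi>\<^sub>n) \<notin> w\<close> for some \<open>\<psi>\<^sub>j \<in> \<Gamma>\<^sub>j\<close> form an ideal, because \<open>\<sigma>\<close> is monotone and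
  distributes over disjunction in each argument, and \<open>\<phi>\<^sub>k\<close> implies none of its members; so some maximal
  consistent set containing \<open>\<phi>\<^sub>k\<close> avoids it. No enumeration of formulas is needed, hence no bound on
  the cardinality of the language.\<close>

section \<open>Provability\<close>

lemma infer_K_mono: "infer_K L X x \<Longrightarrow> X \<subseteq> Y \<Longrightarrow> infer_K L Y x"
  by (induction rule: infer_K.induct) (auto intro: infer_K.intros)

lemma is_proof_K_append:
  assumes "is_proof_K L \<pi>" "is_proof_K L \<pi>'"
  shows "is_proof_K L (\<pi> @ \<pi>')"
  unfolding is_proof_K_def
proof (intro allI impI)
  fix k assume k: "k < length (\<pi> @ \<pi>')"
  show "infer_K L (set (take k (\<pi> @ \<pi>'))) ((\<pi> @ \<pi>') ! k)"
  proof (cases "k < length \<pi>")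
    case True
    then show ?thesis
      using assms(1) by (simp add: is_proof_K_def nth_append)
  next
    case False
    then have "infer_K L (set (take (k - length \<pi>) \<pi>')) (\<pi>' ! (k - length \<pi>))"
      using assms(2) k by (simp add: is_proof_K_def)
    then show ?thesis
      using False by (auto simp: nth_append elim: infer_K_mono)
  qed
qed

lemma is_proof_K_snoc:
  assumes "is_proof_K L \<pi>" "infer_K L (set \<pi>) x"
  shows "is_proof_K L (\<pi> @ [x])"
  using assms by (auto simp: is_proof_K_def nth_append less_Suc_eq)

text \<open>Proofs of the finitely many premises are concatenated and the new step is appended;
  axioms, modus ponens and generalization are then instances.\<close>

lemma provable_K_infer:
  assumes "finite X" "\<And>t \<psi>. (t, \<psi>) \<in> X \<Longrightarrow> provable_K L t \<psi>" "infer_K L X (s, \<phi>)"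
  shows "provable_K L s \<phi>"
proof -
  have "\<exists>\<pi>. is_proof_K L \<pi> \<and> X \<subseteq> set \<pi>"
    using assms(1,2)
  proof (induction X)
    case empty
    have "is_proof_K L []" by (simp add: is_proof_K_def)
    then show ?case by blast
  next
    case (insert x X)
    then obtain \<pi> where \<pi>: "is_proof_K L \<pi>" "X \<subseteq> set \<pi>" by blast
    obtain t \<psi> where x: "x = (t, \<psi>)" by (cases x)
    then obtain \<pi>' where "\<pi>' \<noteq> []" "is_proof_K L \<pi>'" "last \<pi>' = x"
      using insert.prems[of t \<psi>] by (auto simp: provable_K_def)
    then have "is_proof_K L (\<pi> @ \<pi>')" "insert x X \<subseteq> set (\<pi> @ \<pi>')"
      using \<pi> is_proof_K_append by (auto dest: last_in_set)
    then show ?case by blast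
  qed
  then obtain \<pi> where "is_proof_K L \<pi>" "X \<subseteq> set \<pi>" by blast
  then have "is_proof_K L (\<pi> @ [(s, \<phi>)])"
    using is_proof_K_snoc infer_K_mono[OF assms(3)] by blast
  then show ?thesis
    unfolding provable_K_def by (intro exI[of _ "\<pi> @ [(s, \<phi>)]"]) simp
qed

lemma provable_K_axiom: "axiom_K L s \<phi> \<Longrightarrow> provable_K L s \<phi>"
  by (rule provable_K_infer[of "{}"]) (auto intro: infer_K.intros)

lemma provable_K_MP:
  assumes "provable_K L s (Imp \<phi> \<psi>)" "provable_K L s \<phi>"
  shows "provable_K L s \<psi>"
  by (rule provable_K_infer[of "{(s, Imp \<phi> \<psi>), (s, \<phi>)}"])
    (use assms in \<open>auto intro: infer_K.MP[of s \<phi>]\<close>)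

lemma provable_K_UG:
  assumes "\<sigma> \<in> ops L" "i < length (args L \<sigma>)" "provable_K L (args L \<sigma> ! i) \<phi>"
    "list_all2 (\<lambda>t \<psi>. \<psi> \<in> Form L t) (args L \<sigma>) \<psi>s"
  shows "provable_K L (res L \<sigma>) (Box \<sigma> (\<psi>s[i := \<phi>]))"
  by (rule provable_K_infer[of "{(args L \<sigma> ! i, \<phi>)}"])
    (use assms in \<open>auto intro: infer_K.UG\<close>)

text \<open>Strong induction on the position in a proof: \<open>X\<close> is the set of earlier
  entries.\<close>

lemma provable_K_induct [consumes 1, case_names infer]:
  assumes "provable_K L s \<phi>"
    and step: "\<And>X t \<psi>. infer_K L X (t, \<psi>) \<Longrightarrow> (\<And>u \<chi>. (u, \<chi>) \<in> X \<Longrightarrow> P u \<chi>) \<Longrightarrow> P t \<psi>"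
  shows "P s \<phi>"
proof -
  obtain \<pi> where \<pi>: "\<pi> \<noteq> []" "is_proof_K L \<pi>" "last \<pi> = (s, \<phi>)"
    using assms(1) by (auto simp: provable_K_def)
  have "case_prod P (\<pi> ! k)" if "k < length \<pi>" for k
    using that
  proof (induction k rule: less_induct)
    case (less k)
    obtain t \<psi> where k: "\<pi> ! k = (t, \<psi>)" by (cases "\<pi> ! k")
    have "infer_K L (set (take k \<pi>)) (t, \<psi>)"
      using \<pi>(2) less.prems k by (metis is_proof_K_def)
    moreover have "P u \<chi>" if "(u, \<chi>) \<in> set (take k \<pi>)" for u \<chi>
      using that less by (fastforce simp: in_set_conv_nth)
    ultimately show ?case
      using step k by simp
  qed
  from this[of "length \<pi> - 1"] show ?thesis
    using \<pi> by (simp add: last_conv_nth)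
qed

section \<open>Worlds as propositional valuations\<close>

lemma eval_Conj [simp]: "eval v (Conj L s \<phi>s) \<longleftrightarrow> (\<forall>\<phi>\<in>set \<phi>s. eval v \<phi>)"
  by (induction \<phi>s rule: induct_list012) (auto simp: Top_def Bot_def Let_def)

lemma eval_Bot [simp]: "\<not> eval v (Bot L s)"
  by (simp add: Bot_def Let_def)

lemma eval_sat [simp]: "eval (sat L M s w) \<phi> \<longleftrightarrow> sat L M s w \<phi>"
  by (induction \<phi>) auto

lemma sat_Conj: "sat L M s w (Conj L s \<phi>s) \<longleftrightarrow> (\<forall>\<phi>\<in>set \<phi>s. sat L M s w \<phi>)"
  using eval_Conj[of "sat L M s w" L s \<phi>s] unfolding eval_sat .

section \<open>Soundness\<close>

text \<open>Dual to the existential clause for \<open>Op\<close>. Related worlds in a model already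
  have the right sorts, so the membership conjuncts of \<open>sat\<close> disappear.\<close>

lemma sat_Box:
  assumes "is_model L M" "\<sigma> \<in> ops L" "length \<phi>s = length (args L \<sigma>)"
  shows "sat L M s w (Box \<sigma> \<phi>s) \<longleftrightarrow>
    (\<forall>ws. (w, ws) \<in> rel M \<sigma> \<longrightarrow> (\<exists>i < length \<phi>s. sat L M (args L \<sigma> ! i) (ws ! i) (\<phi>s ! i)))"
proof -
  have "ws ! i \<in> worlds M (args L \<sigma> ! i)" if "(w, ws) \<in> rel M \<sigma>" "i < length \<phi>s" for ws i
    using assms that by (fastforce simp: is_model_def is_frame_def list_all2_conv_all_nth)
  then show ?thesis
    by (auto 0 4)
qed

lemma axiom_K_sound:
  assumes "axiom_K L s \<phi>" "is_model L M"
  shows "sat L M s w \<phi>"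
  using assms
proof (induction rule: axiom_K.induct)
  case (Prop s \<phi>)
  then show ?case
    using cpl_sound[of L s \<phi> "sat L M s w"] by simp
next
  case (Distr \<sigma> i \<psi>s \<phi> \<chi>)
  then have len: "length \<psi>s = length (args L \<sigma>)"
    by (simp add: list_all2_lengthD)
  \<comment> \<open>Only the disjunct at position \<open>i\<close> depends on
    \<open>\<theta>\<close>, which reduces \<open>Distr\<close> to modus ponens at
    \<open>ws ! i\<close>.\<close>
  have box: "sat L M (res L \<sigma>) w (Box \<sigma> (\<psi>s[i := \<theta>])) \<longleftrightarrow>
      (\<forall>ws. (w, ws) \<in> rel M \<sigma> \<longrightarrow> sat L M (args L \<sigma> ! i) (ws ! i) \<theta> \<or>
        (\<exists>j < length \<psi>s. j \<noteq> i \<and> sat L M (args L \<sigma> ! j) (ws ! j) (\<psi>s ! j)))" for \<theta>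
    using sat_Box[of L M \<sigma> "\<psi>s[i := \<theta>]"] Distr len
    by (auto simp: nth_list_update split: if_splits) metis+
  have "sat L M (res L \<sigma>) w (Box \<sigma> (\<psi>s[i := \<chi>]))"
    if "sat L M (res L \<sigma>) w (Box \<sigma> (\<psi>s[i := Imp \<phi> \<chi>]))" "sat L M (res L \<sigma>) w (Box \<sigma> (\<psi>s[i := \<phi>]))"
    using that unfolding box by auto
  then show ?case
    by (metis sat.simps(2,3))
qed auto

lemma provable_K_sound:
  assumes "provable_K L s \<phi>" "is_model L M" "w \<in> worlds M s"
  shows "sat L M s w \<phi>"
  using assms(1,3)
proof (induction arbitrary: w rule: provable_K_induct)
  case (infer X t \<psi>)
  show ?case
    using infer.hyps
  proof cases
    case Axiom
    then show ?thesis using assms(2) by (rule axiom_K_sound)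
  next
    case (MP \<phi>)
    then show ?thesis using infer.IH[OF MP(1) infer.prems] infer.IH[OF MP(2) infer.prems] by simp
  next
    case (UG \<sigma> i \<phi> \<psi>s)
    then have len: "length \<psi>s = length (args L \<sigma>)"
      by (simp add: list_all2_lengthD)
    \<comment> \<open>The induction hypothesis thus applies at \<open>ws ! i\<close>, and position
      \<open>i\<close> witnesses the box.\<close>
    have "ws ! i \<in> worlds M (args L \<sigma> ! i)" if "(w, ws) \<in> rel M \<sigma>" for ws
      using assms(2) UG that by (fastforce simp: is_model_def is_frame_def list_all2_conv_all_nth)
    then have "sat L M t w (Box \<sigma> (\<psi>s[i := \<phi>]))"
      using sat_Box[of L M \<sigma> "\<psi>s[i := \<phi>]" t w] assms(2) UG len infer.IH by fastforce
    then show ?thesis using UG by simp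
  qed
qed

lemma derivable_K_sound:
  assumes "derivable_K L s \<Phi> \<phi>"
  shows "consequence TYPE('w) L s \<Phi> \<phi>"
  unfolding consequence_def
proof (intro allI impI ballI)
  fix M :: "('a, 'b, 'c, 'w) model" and w
  assume M: "is_model L M" "w \<in> worlds M s" "\<forall>\<psi>\<in>\<Phi>. sat L M s w \<psi>"
  obtain \<phi>s where "set \<phi>s \<subseteq> \<Phi>" "provable_K L s (Imp (Conj L s \<phi>s) \<phi>)"
    using assms by (auto simp: derivable_K_def)
  then show "sat L M s w \<phi>"
    using provable_K_sound[of L s "Imp (Conj L s \<phi>s) \<phi>" M w] M by (auto simp: sat_Conj)
qed

text \<open>A one-point model with empty relations refutes \<open>Bot\<close>. This consistency
  ensures that the canonical model has worlds of every sort.\<close>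

lemma not_provable_K_Bot: "\<not> provable_K L s (Bot L s)"
proof
  assume *: "provable_K L s (Bot L s)"
  define M :: "('a, 'b, 'c, unit) model"
    where "M = \<lparr>worlds = \<lambda>_. UNIV, rel = \<lambda>_. {}, val = \<lambda>_ _. {}\<rparr>"
  have "is_model L M"
    by (simp add: is_model_def is_frame_def M_def)
  then have "sat L M s () (Bot L s)"
    using provable_K_sound[OF *, of M "()"] by (simp add: M_def)
  then show False
    by (simp add: Bot_def Let_def)
qed

section \<open>Maximal consistent sets\<close>

definition mcs :: "('s, 'o, 'p) language \<Rightarrow> 's \<Rightarrow> ('o, 'p) fm set \<Rightarrow> bool" where
  "mcs L s w \<longleftrightarrow> w \<subseteq> Form L s \<and> \<not> derivable_K L s w (Bot L s) \<and>
     (\<forall>\<phi>\<in>Form L s. \<phi> \<in> w \<or> Neg \<phi> \<in> w)"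

text \<open>Singletons and maximal consistent sets are both directed in this sense, so one invariant
  covers positions before and after enlargement.\<close>

definition directed_fms :: "('s, 'o, 'p) language \<Rightarrow> 's \<Rightarrow> ('o, 'p) fm set \<Rightarrow> bool" where
  "directed_fms L s \<Gamma> \<longleftrightarrow> \<Gamma> \<subseteq> Form L s \<and>
     (\<forall>\<alpha>\<in>\<Gamma>. \<forall>\<beta>\<in>\<Gamma>. \<exists>\<gamma>\<in>\<Gamma>. provable_K L s (Imp \<gamma> \<alpha>) \<and> provable_K L s (Imp \<gamma> \<beta>))"

text \<open>Restricting \<open>rel\<close> and \<open>val\<close> to maximal consistent sets builds
  in the frame and valuation conditions. For a nullary symbol, \<open>(w, [])\<close> is related
  exactly if \<open>Op \<sigma> [] \<in> w\<close>, for each world \<open>w\<close> of the result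
  sort.\<close>

definition canonical :: "('s, 'o, 'p) language \<Rightarrow> ('s, 'o, 'p, ('o, 'p) fm set) model" where
  "canonical L = \<lparr>worlds = \<lambda>s. Collect (mcs L s),
     rel = \<lambda>\<sigma>. {(w, ws). mcs L (res L \<sigma>) w \<and> list_all2 (mcs L) (args L \<sigma>) ws \<and>
       (\<forall>\<psi>s. list_all2 (\<in>) \<psi>s ws \<longrightarrow> Op \<sigma> \<psi>s \<in> w)},
     val = \<lambda>s p. {w. mcs L s w \<and> Var p \<in> w}\<rparr>"

text \<open>Adequacy of \<open>cpl\<close> turns each propositional step below into a check of
  \<open>eval\<close>.\<close>

lemma provable_K_taut:
  assumes "s \<in> sorts L" "\<phi> \<in> Form L s" "\<And>v. eval v \<phi>"
  shows "provable_K L s \<phi>"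
  using assms by (intro provable_K_axiom axiom_K.Prop) (auto simp: cpl_iff_tautology)

context
  fixes L :: "('s, 'o, 'p) language"
  assumes L: "many_sorted_language L"
begin

section \<open>Derivability from premises\<close>

lemma Bot_Form [simp]: "s \<in> sorts L \<Longrightarrow> Bot L s \<in> Form L s"
proof -
  assume "s \<in> sorts L"
  then have "Var (SOME p. p \<in> vars L s) \<in> Form L s"
    using L some_in_eq[of "vars L s"] unfolding many_sorted_language_def Form_def
    by (auto intro!: has_sort.Var)
  then show ?thesis
    by (simp add: Bot_def Let_def)
qed

lemma Conj_Form: "s \<in> sorts L \<Longrightarrow> set \<phi>s \<subseteq> Form L s \<Longrightarrow> Conj L s \<phi>s \<in> Form L s"
  by (induction \<phi>s rule: induct_list012) (auto simp: Top_def)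

text \<open>The premise lists are concatenated. Inferences with one premise pass it twice.\<close>

lemma derivable_K_taut:
  assumes "s \<in> sorts L" "\<Gamma> \<subseteq> Form L s" "\<gamma> \<in> Form L s"
    and "derivable_K L s \<Gamma> \<alpha>" "derivable_K L s \<Gamma> \<beta>"
    and "\<alpha> \<in> Form L s" "\<beta> \<in> Form L s"
    and "\<And>v. eval v \<alpha> \<Longrightarrow> eval v \<beta> \<Longrightarrow> eval v \<gamma>"
  shows "derivable_K L s \<Gamma> \<gamma>"
proof -
  obtain as bs where ab: "set as \<subseteq> \<Gamma>" "provable_K L s (Imp (Conj L s as) \<alpha>)"
      "set bs \<subseteq> \<Gamma>" "provable_K L s (Imp (Conj L s bs) \<beta>)"
    using assms(4,5) by (auto simp: derivable_K_def)
  then have "set as \<subseteq> Form L s" "set bs \<subseteq> Form L s"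
    using assms(2) by auto
  then have F: "Conj L s as \<in> Form L s" "Conj L s bs \<in> Form L s" "Conj L s (as @ bs) \<in> Form L s"
    using assms(1) by (auto intro!: Conj_Form)
  have "provable_K L s (Imp (Imp (Conj L s as) \<alpha>) (Imp (Imp (Conj L s bs) \<beta>)
      (Imp (Conj L s (as @ bs)) \<gamma>)))"
    using F assms by (intro provable_K_taut) auto
  from provable_K_MP[OF provable_K_MP[OF this ab(2)] ab(4)] show ?thesis
    unfolding derivable_K_def using ab(1,3) by (intro exI[of _ "as @ bs"]) auto
qed

lemma derivable_K_member:
  assumes "s \<in> sorts L" "\<phi> \<in> \<Gamma>" "\<phi> \<in> Form L s"
  shows "derivable_K L s \<Gamma> \<phi>"
  unfolding derivable_K_def
  by (rule exI[of _ "[\<phi>]"]) (use assms in \<open>auto intro!: provable_K_taut\<close>)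

lemma derivable_K_provable:
  assumes "s \<in> sorts L" "provable_K L s \<phi>" "\<phi> \<in> Form L s"
  shows "derivable_K L s \<Gamma> \<phi>"
proof -
  have "Conj L s [] \<in> Form L s"
    using assms(1) by (intro Conj_Form) auto
  then have "provable_K L s (Imp \<phi> (Imp (Conj L s []) \<phi>))"
    using assms by (intro provable_K_taut) auto
  from provable_K_MP[OF this assms(2)] show ?thesis
    unfolding derivable_K_def by (intro exI[of _ "[]"]) simp
qed

text \<open>Every occurrence of \<open>\<phi>\<close> is filtered from the premise list; the rest
  together with \<open>\<phi>\<close> propositionally implies the old conjunction.\<close>

lemma derivable_K_deduct:
  assumes "s \<in> sorts L" "\<Gamma> \<subseteq> Form L s" "\<phi> \<in> Form L s" "\<psi> \<in> Form L s"
    and "derivable_K L s (insert \<phi> \<Gamma>) \<psi>"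
  shows "derivable_K L s \<Gamma> (Imp \<phi> \<psi>)"
proof -
  obtain \<phi>s where \<phi>s: "set \<phi>s \<subseteq> insert \<phi> \<Gamma>" "provable_K L s (Imp (Conj L s \<phi>s) \<psi>)"
    using assms(5) by (auto simp: derivable_K_def)
  define \<chi>s where "\<chi>s = filter (\<lambda>\<chi>. \<chi> \<noteq> \<phi>) \<phi>s"
  have \<chi>s: "set \<chi>s \<subseteq> \<Gamma>"
    using \<phi>s(1) by (auto simp: \<chi>s_def)
  have F: "Conj L s \<phi>s \<in> Form L s" "Conj L s \<chi>s \<in> Form L s"
    using \<phi>s(1) \<chi>s assms(1-3) by (auto intro!: Conj_Form)
  have "provable_K L s (Imp (Imp (Conj L s \<phi>s) \<psi>) (Imp (Conj L s \<chi>s) (Imp \<phi> \<psi>)))"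
    using F assms by (intro provable_K_taut) (auto simp: \<chi>s_def)
  from provable_K_MP[OF this \<phi>s(2)] show ?thesis
    unfolding derivable_K_def using \<chi>s by blast
qed

lemma derivable_K_contr:
  assumes "s \<in> sorts L" "\<Gamma> \<subseteq> Form L s" "\<phi> \<in> Form L s"
    and "derivable_K L s (insert (Neg \<phi>) \<Gamma>) (Bot L s)"
  shows "derivable_K L s \<Gamma> \<phi>"
proof -
  have d: "derivable_K L s \<Gamma> (Imp (Neg \<phi>) (Bot L s))"
    using assms by (intro derivable_K_deduct) auto
  show ?thesis
    by (rule derivable_K_taut[OF assms(1-3) d d]) (use assms in auto)
qed

text \<open>Zorn's lemma on the consistent supersets of \<open>\<Gamma>\<close>. If a maximal one
  contained neither \<open>\<phi>\<close> nor its negation, either addition would be inconsistent,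
  so it would derive both \<open>Imp \<phi> (Bot L s)\<close> and \<open>\<phi>\<close>.\<close>

lemma Lindenbaum:
  assumes "s \<in> sorts L" "\<Gamma> \<subseteq> Form L s" "\<not> derivable_K L s \<Gamma> (Bot L s)"
  obtains w where "\<Gamma> \<subseteq> w" "mcs L s w"
proof -
  define A where "A = {\<Delta>. \<Gamma> \<subseteq> \<Delta> \<and> \<Delta> \<subseteq> Form L s \<and> \<not> derivable_K L s \<Delta> (Bot L s)}"
  have "\<exists>w\<in>A. \<forall>X\<in>A. w \<subseteq> X \<longrightarrow> X = w"
  proof (rule subset_Zorn_nonempty)
    show "A \<noteq> {}" using assms by (auto simp: A_def)
    fix C assume C: "C \<noteq> {}" "subset.chain A C"
    then have CA: "C \<subseteq> A" by (simp add: subset_chain_def)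
    have "\<not> derivable_K L s (\<Union>C) (Bot L s)"
    proof
      assume "derivable_K L s (\<Union>C) (Bot L s)"
      then obtain \<phi>s where \<phi>s: "set \<phi>s \<subseteq> \<Union>C" "provable_K L s (Imp (Conj L s \<phi>s) (Bot L s))"
        by (auto simp: derivable_K_def)
      \<comment> \<open>The finitely many premises used lie in a single member of the chain.\<close>
      obtain \<Delta> where "\<Delta> \<in> C" "set \<phi>s \<subseteq> \<Delta>"
        using finite_subset_Union_chain[OF finite_set \<phi>s(1) C] by blast
      then show False
        using CA \<phi>s(2) by (auto simp: A_def derivable_K_def)
    qed
    then show "\<Union>C \<in> A"
      using C(1) CA by (fastforce simp: A_def)
  qed
  then obtain w where w: "w \<in> A" "\<And>X. X \<in> A \<Longrightarrow> w \<subseteq> X \<Longrightarrow> X = w" by blast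
  have wF: "w \<subseteq> Form L s" and wc: "\<not> derivable_K L s w (Bot L s)"
    using w(1) by (auto simp: A_def)
  have max: "derivable_K L s (insert \<phi> w) (Bot L s)" if "\<phi> \<in> Form L s" "\<phi> \<notin> w" for \<phi>
    using w(1) w(2)[of "insert \<phi> w"] that by (auto simp: A_def)
  have "\<phi> \<in> w \<or> Neg \<phi> \<in> w" if \<phi>: "\<phi> \<in> Form L s" for \<phi>
  proof (rule ccontr)
    assume no: "\<not> (\<phi> \<in> w \<or> Neg \<phi> \<in> w)"
    have "derivable_K L s w (Imp \<phi> (Bot L s))" "derivable_K L s w \<phi>"
      using no \<phi> assms(1) wF max
      by (auto intro!: derivable_K_deduct intro: derivable_K_contr)
    then have "derivable_K L s w (Bot L s)"
      by (rule derivable_K_taut[rotated 3]) (use \<phi> assms(1) wF in auto)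
    with wc show False ..
  qed
  then have "mcs L s w"
    using wF wc by (simp add: mcs_def)
  then show ?thesis
    using that w(1) by (auto simp: A_def)
qed

section \<open>Closure properties of maximal consistent sets\<close>

lemma mcs_derivable:
  assumes "s \<in> sorts L" "mcs L s w" "derivable_K L s w \<phi>" "\<phi> \<in> Form L s"
  shows "\<phi> \<in> w"
proof (rule ccontr)
  assume "\<phi> \<notin> w"
  then have *: "derivable_K L s w (Neg \<phi>)"
    using assms by (intro derivable_K_member) (auto simp: mcs_def)
  have "derivable_K L s w (Bot L s)"
    by (rule derivable_K_taut[OF _ _ _ assms(3) *]) (use assms in \<open>auto simp: mcs_def\<close>)
  then show False
    using assms(2) by (simp add: mcs_def)
qed

lemma mcs_provable:
  "s \<in> sorts L \<Longrightarrow> mcs L s w \<Longrightarrow> provable_K L s \<phi> \<Longrightarrow> \<phi> \<in> Form L s \<Longrightarrow> \<phi> \<in> w"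
  by (rule mcs_derivable) (auto intro: derivable_K_provable)

lemma mcs_taut:
  assumes "s \<in> sorts L" "mcs L s w" "\<alpha> \<in> w" "\<beta> \<in> w" "\<gamma> \<in> Form L s"
    and "\<And>v. eval v \<alpha> \<Longrightarrow> eval v \<beta> \<Longrightarrow> eval v \<gamma>"
  shows "\<gamma> \<in> w"
proof -
  have F: "w \<subseteq> Form L s" "\<alpha> \<in> Form L s" "\<beta> \<in> Form L s"
    using assms by (auto simp: mcs_def)
  have "derivable_K L s w \<alpha>" "derivable_K L s w \<beta>"
    using F assms by (auto intro: derivable_K_member)
  then have "derivable_K L s w \<gamma>"
    by (rule derivable_K_taut[rotated 3]) (use F assms in auto)
  then show ?thesis
    using assms mcs_derivable by blast
qed

lemma mcs_Neg:
  assumes "s \<in> sorts L" "mcs L s w" "\<phi> \<in> Form L s"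
  shows "Neg \<phi> \<in> w \<longleftrightarrow> \<phi> \<notin> w"
proof -
  have "\<not> (\<phi> \<in> w \<and> Neg \<phi> \<in> w)"
  proof
    assume "\<phi> \<in> w \<and> Neg \<phi> \<in> w"
    then have "Bot L s \<in> w"
      by (auto intro!: mcs_taut[OF assms(1,2), of \<phi> "Neg \<phi>"] simp: assms(1))
    then show False
      using assms derivable_K_member[of s "Bot L s" w] by (auto simp: mcs_def)
  qed
  then show ?thesis
    using assms by (auto simp: mcs_def)
qed

lemma mcs_Imp:
  assumes "s \<in> sorts L" "mcs L s w" "Imp \<alpha> \<beta> \<in> w" "\<alpha> \<in> w"
  shows "\<beta> \<in> w"
  by (rule mcs_taut[OF assms]) (use assms in \<open>auto simp: mcs_def\<close>)

lemma mcs_Or: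
  assumes "s \<in> sorts L" "mcs L s w" "\<alpha> \<in> Form L s" "\<beta> \<in> Form L s"
  shows "Or \<alpha> \<beta> \<in> w \<longleftrightarrow> \<alpha> \<in> w \<or> \<beta> \<in> w"
proof -
  have "Or \<alpha> \<beta> \<in> w" if "\<alpha> \<in> w \<or> \<beta> \<in> w"
    using that mcs_taut[OF assms(1,2), of \<alpha> \<alpha> "Or \<alpha> \<beta>"] mcs_taut[OF assms(1,2), of \<beta> \<beta> "Or \<alpha> \<beta>"]
      assms(3,4) by auto
  moreover have "\<beta> \<in> w" if "Or \<alpha> \<beta> \<in> w" "\<alpha> \<notin> w"
    by (rule mcs_taut[OF assms(1,2), of "Or \<alpha> \<beta>" "Neg \<alpha>"]) (use that assms mcs_Neg in auto)
  ultimately show ?thesis by blast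
qed

text \<open>Conjunctions are the common lower bounds. This preserves the directedness invariant once
  a position has been enlarged.\<close>

lemma mcs_directed:
  assumes "s \<in> sorts L" "mcs L s w"
  shows "directed_fms L s w"
  unfolding directed_fms_def
proof (intro conjI ballI)
  show F: "w \<subseteq> Form L s" using assms by (simp add: mcs_def)
  fix \<alpha> \<beta> assume ab: "\<alpha> \<in> w" "\<beta> \<in> w"
  then have "And \<alpha> \<beta> \<in> w"
    using F by (intro mcs_taut[OF assms ab]) auto
  moreover have "provable_K L s (Imp (And \<alpha> \<beta>) \<alpha>)" "provable_K L s (Imp (And \<alpha> \<beta>) \<beta>)"
    using ab F assms(1) by (auto intro!: provable_K_taut)
  ultimately show "\<exists>\<gamma>\<in>w. provable_K L s (Imp \<gamma> \<alpha>) \<and> provable_K L s (Imp \<gamma> \<beta>)" by blast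
qed

lemma ex_mcs: "s \<in> sorts L \<Longrightarrow> \<exists>w. mcs L s w"
proof -
  assume s: "s \<in> sorts L"
  have "\<not> derivable_K L s {} (Bot L s)"
  proof
    assume "derivable_K L s {} (Bot L s)"
    \<comment> \<open>The only premise list drawn from \<open>{}\<close> is empty, and its
      \<open>Conj\<close> is \<open>Top\<close>.\<close>
    then have *: "provable_K L s (Imp (Top L s) (Bot L s))"
      by (simp add: derivable_K_def)
    have "provable_K L s (Top L s)"
      using s by (intro provable_K_taut) (auto simp: Top_def)
    from provable_K_MP[OF * this] show False
      by (rule not_provable_K_Bot[THEN notE])
  qed
  then show ?thesis
    using Lindenbaum[OF s, of "{}"] by blast
qed

section \<open>The existence lemma\<close>

context
  fixes \<sigma> :: 'o and w :: "('o, 'p) fm set"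
  assumes \<sigma>: "\<sigma> \<in> ops L" and w: "mcs L (res L \<sigma>) w"
begin

abbreviation (input) "ar \<equiv> args L \<sigma>"
abbreviation (input) "well_sorted \<equiv> list_all2 (\<lambda>t \<psi>. \<psi> \<in> Form L t) (args L \<sigma>)"

lemma res_sort: "res L \<sigma> \<in> sorts L"
  and arg_sort: "i < length ar \<Longrightarrow> ar ! i \<in> sorts L"
  using L \<sigma> nth_mem[of i "args L \<sigma>"] unfolding many_sorted_language_def by blast+

section \<open>Modal reasoning inside a maximal consistent set\<close>

lemma Op_Form: "well_sorted \<psi>s \<Longrightarrow> Op \<sigma> \<psi>s \<in> Form L (res L \<sigma>)"
  using \<sigma> by (auto simp: Form_def intro: has_sort.Op)

lemma well_sorted_Neg: "well_sorted \<psi>s \<Longrightarrow> well_sorted (map Neg \<psi>s)"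
  by (simp add: list_all2_conv_all_nth)

lemma well_sorted_update:
  "well_sorted \<psi>s \<Longrightarrow> i < length ar \<Longrightarrow> \<alpha> \<in> Form L (ar ! i) \<Longrightarrow> well_sorted (\<psi>s[i := \<alpha>])"
  by (simp add: list_all2_conv_all_nth nth_list_update)

text \<open>The box carries doubled negations, so it is not literally the negation of
  \<open>Op \<sigma> \<psi>s\<close>; axiom \<open>Dual\<close> bridges the gap. The index
  \<open>i\<close> expresses the positive arity that \<open>Dual\<close> demands.\<close>

lemma Op_mcs_Box:
  assumes "well_sorted \<psi>s" "i < length ar"
  shows "Op \<sigma> \<psi>s \<in> w \<longleftrightarrow> Box \<sigma> (map Neg \<psi>s) \<notin> w"
proof -
  let ?A = "Op \<sigma> \<psi>s" and ?B = "Neg (Box \<sigma> (map Neg \<psi>s))"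
  note F = Op_Form[OF assms(1)] Op_Form[OF well_sorted_Neg[OF well_sorted_Neg[OF assms(1)]]]
  have *: "Iff ?A ?B \<in> w"
    using F assms \<sigma> by (intro mcs_provable[OF res_sort w] provable_K_axiom axiom_K.Dual) auto
  have "?B \<in> w" if "?A \<in> w"
    by (rule mcs_taut[OF res_sort w * that]) (use F in auto)
  moreover have "?A \<in> w" if "?B \<in> w"
    by (rule mcs_taut[OF res_sort w * that]) (use F in auto)
  ultimately show ?thesis
    using mcs_Neg[OF res_sort w, of "Box \<sigma> (map Neg \<psi>s)"] F by auto
qed

lemma mcs_Box_Imp:
  assumes "well_sorted \<psi>s" "i < length ar" "\<alpha> \<in> Form L (ar ! i)" "\<beta> \<in> Form L (ar ! i)"
    and "Box \<sigma> (\<psi>s[i := Imp \<alpha> \<beta>]) \<in> w" "Box \<sigma> (\<psi>s[i := \<alpha>]) \<in> w"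
  shows "Box \<sigma> (\<psi>s[i := \<beta>]) \<in> w"
proof -
  have F: "Box \<sigma> (\<psi>s[i := \<theta>]) \<in> Form L (res L \<sigma>)" if "\<theta> \<in> Form L (ar ! i)" for \<theta>
    using Op_Form[OF well_sorted_Neg[OF well_sorted_update[OF assms(1,2) that]]] by simp
  have "Imp (Box \<sigma> (\<psi>s[i := Imp \<alpha> \<beta>])) (Imp (Box \<sigma> (\<psi>s[i := \<alpha>])) (Box \<sigma> (\<psi>s[i := \<beta>]))) \<in> w"
    using F[of \<alpha>] F[of \<beta>] F[of "Imp \<alpha> \<beta>"] assms \<sigma>
    by (intro mcs_provable[OF res_sort w] provable_K_axiom axiom_K.Distr) auto
  then show ?thesis
    using mcs_Imp[OF res_sort w] assms(5,6) by blast
qed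

lemma mcs_Box_provable:
  assumes "well_sorted \<psi>s" "i < length ar" "\<alpha> \<in> Form L (ar ! i)" "provable_K L (ar ! i) \<alpha>"
  shows "Box \<sigma> (\<psi>s[i := \<alpha>]) \<in> w"
  using Op_Form[OF well_sorted_Neg[OF well_sorted_update[OF assms(1-3)]]]
  by (intro mcs_provable[OF res_sort w] provable_K_UG) (use assms \<sigma> in auto)

text \<open>By contraposition: a propositional consequence of the implication is boxed, and two uses
  of distribution turn the boxes of \<open>Neg \<alpha>\<close> and \<open>Neg \<beta>\<close> into
  that of \<open>Neg \<gamma>\<close>. Taking \<open>Or \<alpha> \<beta>\<close> for
  \<open>\<gamma>\<close> gives additivity; equal \<open>\<alpha>\<close> and \<open>\<beta>\<close>
  give monotonicity.\<close>

lemma Op_mcs_split: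
  assumes "well_sorted \<psi>s" "i < length ar"
    and F: "\<alpha> \<in> Form L (ar ! i)" "\<beta> \<in> Form L (ar ! i)" "\<gamma> \<in> Form L (ar ! i)"
    and "provable_K L (ar ! i) (Imp \<gamma> (Or \<alpha> \<beta>))" "Op \<sigma> (\<psi>s[i := \<gamma>]) \<in> w"
  shows "Op \<sigma> (\<psi>s[i := \<alpha>]) \<in> w \<or> Op \<sigma> (\<psi>s[i := \<beta>]) \<in> w"
proof (rule ccontr)
  assume no: "\<not> ?thesis"
  let ?\<chi>s = "map Neg \<psi>s"
  have box: "Op \<sigma> (\<psi>s[i := \<theta>]) \<in> w \<longleftrightarrow> Box \<sigma> (?\<chi>s[i := Neg \<theta>]) \<notin> w"
    if "\<theta> \<in> Form L (ar ! i)" for \<theta>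
    using Op_mcs_Box[OF well_sorted_update[OF assms(1,2) that] assms(2)]
    by (simp add: map_update)
  have "provable_K L (ar ! i)
      (Imp (Imp \<gamma> (Or \<alpha> \<beta>)) (Imp (Neg \<alpha>) (Imp (Neg \<beta>) (Neg \<gamma>))))"
    using F arg_sort[OF assms(2)] by (intro provable_K_taut) auto
  from provable_K_MP[OF this assms(6)]
  have "Box \<sigma> (?\<chi>s[i := Imp (Neg \<alpha>) (Imp (Neg \<beta>) (Neg \<gamma>))]) \<in> w"
    using F by (intro mcs_Box_provable[OF well_sorted_Neg[OF assms(1)] assms(2)]) auto
  from mcs_Box_Imp[OF well_sorted_Neg[OF assms(1)] assms(2) _ _ this]
  have "Box \<sigma> (?\<chi>s[i := Imp (Neg \<beta>) (Neg \<gamma>)]) \<in> w"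
    using F no box[OF F(1)] by simp
  from mcs_Box_Imp[OF well_sorted_Neg[OF assms(1)] assms(2) _ _ this]
  have "Box \<sigma> (?\<chi>s[i := Neg \<gamma>]) \<in> w"
    using F no box[OF F(2)] by simp
  then show False
    using box F(3) assms(7) by blast
qed

lemma Op_mcs_mono1:
  assumes "well_sorted \<psi>s" "i < length ar" "\<alpha> \<in> Form L (ar ! i)" "\<gamma> \<in> Form L (ar ! i)"
    and "provable_K L (ar ! i) (Imp \<gamma> \<alpha>)" "Op \<sigma> (\<psi>s[i := \<gamma>]) \<in> w"
  shows "Op \<sigma> (\<psi>s[i := \<alpha>]) \<in> w"
proof -
  have "provable_K L (ar ! i) (Imp (Imp \<gamma> \<alpha>) (Imp \<gamma> (Or \<alpha> \<alpha>)))"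
    using assms arg_sort by (intro provable_K_taut) auto
  from provable_K_MP[OF this assms(5)] show ?thesis
    using Op_mcs_split[of \<psi>s i \<alpha> \<alpha> \<gamma>] assms by blast
qed

lemma Op_mcs_mono:
  assumes "well_sorted as" "well_sorted bs"
    and "\<And>i. i < length ar \<Longrightarrow> provable_K L (ar ! i) (Imp (as ! i) (bs ! i))"
    and "Op \<sigma> as \<in> w"
  shows "Op \<sigma> bs \<in> w"
proof -
  have len: "length as = length ar" "length bs = length ar"
    using assms(1,2)[THEN list_all2_lengthD] by auto
  have nth: "as ! i \<in> Form L (ar ! i)" "bs ! i \<in> Form L (ar ! i)" if "i < length ar" for i
    using that assms(1,2) by (auto simp: list_all2_conv_all_nth)
  \<comment> \<open>Arguments are exchanged one at a time from the left: the first \<open>k\<close>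
    already come from \<open>bs\<close>.\<close>
  have "Op \<sigma> (take k bs @ drop k as) \<in> w" if "k \<le> length ar" for k
    using that
  proof (induction k)
    case 0
    then show ?case using assms(4) by simp
  next
    case (Suc k)
    let ?cs = "take k bs @ drop k as"
    have cs: "well_sorted ?cs"
      using nth len Suc.prems by (auto simp: list_all2_conv_all_nth nth_append)
    have "drop k as = as ! k # drop (Suc k) as"
      using len Suc.prems by (simp add: Cons_nth_drop_Suc)
    then have "?cs[k := as ! k] = ?cs" "?cs[k := bs ! k] = take (Suc k) bs @ drop (Suc k) as"
      using len Suc.prems by (simp_all add: list_update_append take_Suc_conv_app_nth)
    then show ?case
      using Op_mcs_mono1[OF cs, of k "bs ! k" "as ! k"] Suc nth assms(3)[of k] by simp
  qed
  from this[of "length ar"] show ?thesis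
    using len by simp
qed

text \<open>The other positions stay unchanged and the condition on \<open>Op\<close> survives, so
  the enlargement can be repeated at the next position.\<close>

lemma extend_position:
  assumes \<Gamma>: "list_all2 (directed_fms L) ar \<Gamma>s" "\<And>\<psi>s. list_all2 (\<in>) \<psi>s \<Gamma>s \<Longrightarrow> Op \<sigma> \<psi>s \<in> w"
    and \<phi>: "list_all2 (\<in>) \<phi>s \<Gamma>s" and k: "k < length ar"
  obtains u where "mcs L (ar ! k) u" "\<phi>s ! k \<in> u"
    "\<And>\<psi>s. list_all2 (\<in>) \<psi>s (\<Gamma>s[k := u]) \<Longrightarrow> Op \<sigma> \<psi>s \<in> w"
proof -
  let ?t = "ar ! k"
  have len: "length \<Gamma>s = length ar" "length \<phi>s = length ar"
    using \<Gamma>(1) \<phi> by (auto simp: list_all2_lengthD)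
  have well_sorted: "well_sorted \<psi>s" if "list_all2 (\<in>) \<psi>s \<Gamma>s" for \<psi>s
    using that \<Gamma>(1) by (fastforce simp: list_all2_conv_all_nth directed_fms_def)
  have t: "?t \<in> sorts L"
    using arg_sort[OF k] .
  have \<phi>F: "\<phi>s ! k \<in> Form L ?t"
    using well_sorted[OF \<phi>] k by (simp add: list_all2_conv_all_nth)
  \<comment> \<open>The ideal to be avoided: formulas rejected at position \<open>k\<close> by some
    choice at the other positions. The entry of \<open>\<psi>s\<close> at \<open>k\<close> is
    overwritten.\<close>
  define I where
    "I = {\<alpha> \<in> Form L ?t. \<exists>\<psi>s. list_all2 (\<in>) \<psi>s \<Gamma>s \<and> Op \<sigma> (\<psi>s[k := \<alpha>]) \<notin> w}"
  have IF: "I \<subseteq> Form L ?t" by (auto simp: I_def)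
  \<comment> \<open>\<open>Bot\<close> serves as the empty disjunction in
    \<open>join_I\<close>.\<close>
  have Bot_I: "Bot L ?t \<in> I"
  proof -
    have "provable_K L ?t (Neg (Bot L ?t))"
      using t by (intro provable_K_taut) auto
    then have "Box \<sigma> ((map Neg \<phi>s)[k := Neg (Bot L ?t)]) \<in> w"
      using t by (intro mcs_Box_provable[OF well_sorted_Neg[OF well_sorted[OF \<phi>]] k]) auto
    then have "Op \<sigma> (\<phi>s[k := Bot L ?t]) \<notin> w"
      using Op_mcs_Box[OF well_sorted_update[OF well_sorted[OF \<phi>] k, of "Bot L ?t"] k] t
      by (simp add: map_update)
    then show ?thesis
      using \<phi> t by (auto simp: I_def)
  qed
  have Or_I: "Or \<alpha> \<beta> \<in> I" if ab: "\<alpha> \<in> I" "\<beta> \<in> I" for \<alpha> \<beta>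
  proof -
    obtain as bs where as: "list_all2 (\<in>) as \<Gamma>s" "Op \<sigma> (as[k := \<alpha>]) \<notin> w"
      and bs: "list_all2 (\<in>) bs \<Gamma>s" "Op \<sigma> (bs[k := \<beta>]) \<notin> w"
      using ab by (auto simp: I_def)
    have F: "\<alpha> \<in> Form L ?t" "\<beta> \<in> Form L ?t"
      using ab IF by auto
    \<comment> \<open>Directedness merges the two rejecting choices into one below both; by
      monotonicity that single choice rejects both \<open>\<alpha>\<close> and
      \<open>\<beta>\<close>, hence by additivity their disjunction.\<close>
    have "\<forall>i<length ar. \<exists>\<gamma>. \<gamma> \<in> \<Gamma>s ! i \<and> provable_K L (ar ! i) (Imp \<gamma> (as ! i)) \<and>
        provable_K L (ar ! i) (Imp \<gamma> (bs ! i))"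
      using \<Gamma>(1) as(1) bs(1) unfolding list_all2_conv_all_nth directed_fms_def by metis
    then obtain c where c: "\<And>i. i < length ar \<Longrightarrow> c i \<in> \<Gamma>s ! i \<and>
        provable_K L (ar ! i) (Imp (c i) (as ! i)) \<and> provable_K L (ar ! i) (Imp (c i) (bs ! i))"
      by metis
    define cs where "cs = map c [0..<length ar]"
    have cs: "list_all2 (\<in>) cs \<Gamma>s"
      using c len by (simp add: cs_def list_all2_conv_all_nth)
    have below: "Op \<sigma> (ds[k := \<theta>]) \<in> w"
      if "Op \<sigma> (cs[k := \<theta>]) \<in> w" "\<theta> \<in> Form L ?t" "list_all2 (\<in>) ds \<Gamma>s"
        "\<And>i. i < length ar \<Longrightarrow> provable_K L (ar ! i) (Imp (c i) (ds ! i))" for ds \<theta>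
    proof (rule Op_mcs_mono[OF _ _ _ that(1)])
      show "well_sorted (cs[k := \<theta>])" "well_sorted (ds[k := \<theta>])"
        using that well_sorted cs k by (auto intro: well_sorted_update)
      have "provable_K L ?t (Imp \<theta> \<theta>)"
        using that(2) t by (intro provable_K_taut) auto
      then show "provable_K L (ar ! i) (Imp (cs[k := \<theta>] ! i) (ds[k := \<theta>] ! i))"
        if "i < length ar" for i
        using that \<open>\<And>i. i < length ar \<Longrightarrow> provable_K L (ar ! i) (Imp (c i) (ds ! i))\<close>
          len list_all2_lengthD[OF \<open>list_all2 (\<in>) ds \<Gamma>s\<close>]
        by (cases "i = k") (simp_all add: cs_def)
    qed
    have "provable_K L ?t (Imp (Or \<alpha> \<beta>) (Or \<alpha> \<beta>))"
      using F t by (intro provable_K_taut) auto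
    then have "Op \<sigma> (cs[k := Or \<alpha> \<beta>]) \<notin> w"
      using Op_mcs_split[OF well_sorted[OF cs] k F, of "Or \<alpha> \<beta>"] below as bs c F by auto
    then show ?thesis
      using cs F by (auto simp: I_def)
  qed
  \<comment> \<open>De Morgan: a finite conjunction of negated members of \<open>I\<close> is
    propositionally the negation of one member.\<close>
  have join_I: "\<exists>\<gamma>\<in>I. \<forall>v. eval v \<gamma> \<longleftrightarrow> (\<exists>\<theta>\<in>set \<theta>s. eval v (Neg \<theta>))"
    if "set \<theta>s \<subseteq> Neg ` I" for \<theta>s
    using that
  proof (induction \<theta>s)
    case Nil
    then show ?case using Bot_I by (intro bexI[of _ "Bot L ?t"]) auto
  next
    case (Cons \<theta> \<theta>s)
    then obtain \<gamma> where \<gamma>: "\<gamma> \<in> I" "\<forall>v. eval v \<gamma> \<longleftrightarrow> (\<exists>\<theta>\<in>set \<theta>s. eval v (Neg \<theta>))"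
      by auto
    obtain \<alpha> where "\<alpha> \<in> I" "\<theta> = Neg \<alpha>"
      using Cons.prems by auto
    then show ?case
      using \<gamma> Or_I[of \<alpha> \<gamma>] by (intro bexI[of _ "Or \<alpha> \<gamma>"]) auto
  qed
  have NIF: "Neg ` I \<subseteq> Form L ?t"
    using IF by auto
  have "\<not> derivable_K L ?t (insert (\<phi>s ! k) (Neg ` I)) (Bot L ?t)"
  proof
    assume "derivable_K L ?t (insert (\<phi>s ! k) (Neg ` I)) (Bot L ?t)"
    then have "derivable_K L ?t (Neg ` I) (Imp (\<phi>s ! k) (Bot L ?t))"
      using t \<phi>F NIF by (intro derivable_K_deduct) auto
    then obtain \<theta>s where \<theta>s: "set \<theta>s \<subseteq> Neg ` I"
        "provable_K L ?t (Imp (Conj L ?t \<theta>s) (Imp (\<phi>s ! k) (Bot L ?t)))"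
      by (auto simp: derivable_K_def)
    obtain \<gamma> where \<gamma>: "\<gamma> \<in> I" "\<And>v. eval v \<gamma> \<longleftrightarrow> (\<exists>\<theta>\<in>set \<theta>s. eval v (Neg \<theta>))"
      using join_I[OF \<theta>s(1)] by blast
    have \<gamma>F: "\<gamma> \<in> Form L ?t"
      using \<gamma>(1) IF by auto
    have "Conj L ?t \<theta>s \<in> Form L ?t"
      using \<theta>s(1) NIF t by (intro Conj_Form) auto
    then have "provable_K L ?t (Imp (Imp (Conj L ?t \<theta>s) (Imp (\<phi>s ! k) (Bot L ?t)))
        (Imp (\<phi>s ! k) \<gamma>))"
      using t \<phi>F \<gamma>F by (intro provable_K_taut) (auto simp: \<gamma>(2))
    from provable_K_MP[OF this \<theta>s(2)] have imp: "provable_K L ?t (Imp (\<phi>s ! k) \<gamma>)" .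
    obtain \<psi>s where \<psi>s: "list_all2 (\<in>) \<psi>s \<Gamma>s" "Op \<sigma> (\<psi>s[k := \<gamma>]) \<notin> w"
      using \<gamma>(1) by (auto simp: I_def)
    \<comment> \<open>With \<open>\<phi>s ! k\<close> at position \<open>k\<close> the list is drawn
      from \<open>\<Gamma>s\<close>, so its \<open>Op\<close> formula lies in \<open>w\<close>;
      monotonicity along \<open>imp\<close> contradicts the rejection of
      \<open>\<gamma>\<close>.\<close>
    have "list_all2 (\<in>) (\<psi>s[k := \<phi>s ! k]) \<Gamma>s"
      using \<psi>s(1) \<phi> k len by (auto simp: list_all2_conv_all_nth nth_list_update)
    then show False
      using Op_mcs_mono1[OF well_sorted[OF \<psi>s(1)] k \<gamma>F \<phi>F imp] \<Gamma>(2) \<psi>s(2) by blast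
  qed
  then obtain u where u: "insert (\<phi>s ! k) (Neg ` I) \<subseteq> u" "mcs L ?t u"
    using Lindenbaum[OF t, of "insert (\<phi>s ! k) (Neg ` I)"] \<phi>F NIF by auto
  have "Op \<sigma> \<psi>s \<in> w" if \<psi>s: "list_all2 (\<in>) \<psi>s (\<Gamma>s[k := u])" for \<psi>s
  proof (rule ccontr)
    assume no: "Op \<sigma> \<psi>s \<notin> w"
    have "\<psi>s ! k \<in> u"
      using list_all2_nthD2[OF \<psi>s, of k] k len by simp
    then have \<psi>k: "\<psi>s ! k \<in> u" "\<psi>s ! k \<in> Form L ?t"
      using u(2) by (auto simp: mcs_def)
    \<comment> \<open>Here \<open>\<phi>s ! k\<close> is a placeholder from
      \<open>\<Gamma>s ! k\<close>: overwriting it by \<open>\<psi>s ! k\<close> restores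
      \<open>\<psi>s\<close>, so rejecting \<open>\<psi>s\<close> would put
      \<open>\<psi>s ! k\<close> into \<open>I\<close>.\<close>
    have "list_all2 (\<in>) (\<psi>s[k := \<phi>s ! k]) \<Gamma>s"
      using \<psi>s \<phi> k len by (auto simp: list_all2_conv_all_nth nth_list_update)
    moreover have "\<psi>s[k := \<phi>s ! k, k := \<psi>s ! k] = \<psi>s"
      by simp
    ultimately have "\<psi>s ! k \<in> I"
      unfolding I_def using \<psi>k no by (metis (mono_tags, lifting) mem_Collect_eq)
    then show False
      using u mcs_Neg[OF t u(2) \<psi>k(2)] \<psi>k(1) by auto
  qed
  then show ?thesis
    using that u by auto
qed

lemma Op_mcs_witnesses:
  assumes "well_sorted \<phi>s" "Op \<sigma> \<phi>s \<in> w"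
  obtains ws where "list_all2 (mcs L) ar ws" "list_all2 (\<in>) \<phi>s ws"
    "\<And>\<psi>s. list_all2 (\<in>) \<psi>s ws \<Longrightarrow> Op \<sigma> \<psi>s \<in> w"
proof -
  have len: "length \<phi>s = length ar"
    using assms(1) by (simp add: list_all2_lengthD)
  \<comment> \<open>Positions are enlarged from left to right: the first \<open>k\<close> sets are
    maximal consistent, and directedness is kept everywhere.\<close>
  have "\<exists>\<Gamma>s. list_all2 (directed_fms L) ar \<Gamma>s \<and> list_all2 (\<in>) \<phi>s \<Gamma>s \<and>
      (\<forall>\<psi>s. list_all2 (\<in>) \<psi>s \<Gamma>s \<longrightarrow> Op \<sigma> \<psi>s \<in> w) \<and> (\<forall>i<k. mcs L (ar ! i) (\<Gamma>s ! i))"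
    if "k \<le> length ar" for k
    using that
  proof (induction k)
    case 0
    have "directed_fms L (ar ! i) {\<phi>s ! i}" if "i < length ar" for i
      using that assms(1) arg_sort[OF that]
      by (auto simp: directed_fms_def list_all2_conv_all_nth intro!: provable_K_taut)
    \<comment> \<open>Singletons leave \<open>\<phi>s\<close> as the only choice, so the condition
      on \<open>Op\<close> is \<open>assms(2)\<close>.\<close>
    moreover have "\<psi>s = \<phi>s" if "list_all2 (\<in>) \<psi>s (map (\<lambda>\<phi>. {\<phi>}) \<phi>s)" for \<psi>s
      using that by (auto simp: list_all2_conv_all_nth list_eq_iff_nth_eq)
    ultimately show ?case
      using len assms(2)
      by (intro exI[of _ "map (\<lambda>\<phi>. {\<phi>}) \<phi>s"]) (auto simp: list_all2_conv_all_nth)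
  next
    case (Suc k)
    then obtain \<Gamma>s where \<Gamma>s: "list_all2 (directed_fms L) ar \<Gamma>s" "list_all2 (\<in>) \<phi>s \<Gamma>s"
        "\<And>\<psi>s. list_all2 (\<in>) \<psi>s \<Gamma>s \<Longrightarrow> Op \<sigma> \<psi>s \<in> w" "\<And>i. i < k \<Longrightarrow> mcs L (ar ! i) (\<Gamma>s ! i)"
      by auto
    have k: "k < length ar" using Suc.prems by simp
    obtain u where u: "mcs L (ar ! k) u" "\<phi>s ! k \<in> u"
        "\<And>\<psi>s. list_all2 (\<in>) \<psi>s (\<Gamma>s[k := u]) \<Longrightarrow> Op \<sigma> \<psi>s \<in> w"
      using extend_position[OF \<Gamma>s(1,3,2) k] by blast
    then show ?case
      using \<Gamma>s k mcs_directed[OF arg_sort[OF k] u(1)]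
      by (intro exI[of _ "\<Gamma>s[k := u]"])
        (auto simp: list_all2_conv_all_nth nth_list_update less_Suc_eq)
  qed
  from this[of "length ar"] obtain \<Gamma>s where "list_all2 (directed_fms L) ar \<Gamma>s"
      "list_all2 (\<in>) \<phi>s \<Gamma>s" "\<forall>\<psi>s. list_all2 (\<in>) \<psi>s \<Gamma>s \<longrightarrow> Op \<sigma> \<psi>s \<in> w"
      "\<forall>i<length ar. mcs L (ar ! i) (\<Gamma>s ! i)"
    by auto
  then show ?thesis
    using that[of \<Gamma>s] by (auto simp: list_all2_conv_all_nth)
qed

end

section \<open>The canonical model\<close>

lemma canonical_is_model: "is_model L (canonical L)"
  using ex_mcs unfolding is_model_def is_frame_def canonical_def
  by (auto simp: list_all2_conv_all_nth)

text \<open>In the \<open>Op\<close> case, satisfaction implies membership by definition of the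
  canonical relation; the converse is \<open>Op_mcs_witnesses\<close>.\<close>

lemma truth_lemma:
  assumes "has_sort L s \<phi>" "s \<in> sorts L" "mcs L s w"
  shows "sat L (canonical L) s w \<phi> \<longleftrightarrow> \<phi> \<in> w"
  using assms
proof (induction arbitrary: w rule: has_sort.induct)
  case (Var s p)
  then show ?case by (simp add: canonical_def)
next
  case (Neg s \<phi>)
  then show ?case by (simp add: mcs_Neg Form_def)
next
  case (Or s \<phi> \<psi>)
  then show ?case by (simp add: mcs_Or Form_def)
next
  case (Op \<sigma> \<phi>s)
  have well_sorted: "list_all2 (\<lambda>t \<psi>. \<psi> \<in> Form L t) (args L \<sigma>) \<phi>s"
    using Op.IH by (auto simp: list_all2_conv_all_nth Form_def)
  have len: "length \<phi>s = length (args L \<sigma>)"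
    using well_sorted by (simp add: list_all2_lengthD)
  have IH: "sat L (canonical L) (args L \<sigma> ! i) u (\<phi>s ! i) \<longleftrightarrow> \<phi>s ! i \<in> u"
    if "i < length (args L \<sigma>)" "mcs L (args L \<sigma> ! i) u" for i u
    using Op.IH that arg_sort[OF Op.hyps(1) Op.prems(2) that(1)]
    by (auto simp: list_all2_conv_all_nth)
  show ?case
  proof
    assume "sat L (canonical L) (res L \<sigma>) w (Op \<sigma> \<phi>s)"
    then obtain ws where ws: "(w, ws) \<in> rel (canonical L) \<sigma>"
        "\<And>i. i < length \<phi>s \<Longrightarrow> sat L (canonical L) (args L \<sigma> ! i) (ws ! i) (\<phi>s ! i)"
      by auto
    then have "list_all2 (mcs L) (args L \<sigma>) ws" "\<And>\<psi>s. list_all2 (\<in>) \<psi>s ws \<Longrightarrow> Op \<sigma> \<psi>s \<in> w"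
      by (auto simp: canonical_def)
    moreover from this(1) have "list_all2 (\<in>) \<phi>s ws"
      using ws(2) IH len by (auto simp: list_all2_conv_all_nth)
    ultimately show "Op \<sigma> \<phi>s \<in> w" by blast
  next
    assume "Op \<sigma> \<phi>s \<in> w"
    then obtain ws where ws: "list_all2 (mcs L) (args L \<sigma>) ws" "list_all2 (\<in>) \<phi>s ws"
        "\<And>\<psi>s. list_all2 (\<in>) \<psi>s ws \<Longrightarrow> Op \<sigma> \<psi>s \<in> w"
      using Op_mcs_witnesses[OF Op.hyps(1) Op.prems(2) well_sorted] by blast
    have "(w, ws) \<in> rel (canonical L) \<sigma>"
      using ws Op.prems(2) by (simp add: canonical_def)
    moreover have "ws ! i \<in> worlds (canonical L) (args L \<sigma> ! i) \<and>
        sat L (canonical L) (args L \<sigma> ! i) (ws ! i) (\<phi>s ! i)" if "i < length \<phi>s" for i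
      using that ws(1,2) IH len by (auto simp: list_all2_conv_all_nth canonical_def)
    ultimately show "sat L (canonical L) (res L \<sigma>) w (Op \<sigma> \<phi>s)"
      by auto
  qed
qed

text \<open>If the derivation fails, \<open>insert (Neg \<phi>) \<Phi>\<close> is consistent, and a
  maximal consistent extension is a canonical world satisfying \<open>\<Phi>\<close> but not
  \<open>\<phi>\<close>.\<close>

lemma derivable_K_complete:
  assumes "s \<in> sorts L" "\<phi> \<in> Form L s" "\<Phi> \<subseteq> Form L s"
    and "consequence TYPE(('o, 'p) fm set) L s \<Phi> \<phi>"
  shows "derivable_K L s \<Phi> \<phi>"
proof (rule ccontr)
  assume "\<not> derivable_K L s \<Phi> \<phi>"
  then have "\<not> derivable_K L s (insert (Neg \<phi>) \<Phi>) (Bot L s)"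
    using derivable_K_contr assms by blast
  then obtain w where w: "insert (Neg \<phi>) \<Phi> \<subseteq> w" "mcs L s w"
    using Lindenbaum[OF assms(1), of "insert (Neg \<phi>) \<Phi>"] assms(2,3) by auto
  have "sat L (canonical L) s w \<psi> \<longleftrightarrow> \<psi> \<in> w" if "\<psi> \<in> Form L s" for \<psi>
    using truth_lemma that assms(1) w(2) by (simp add: Form_def)
  moreover have "w \<in> worlds (canonical L) s"
    using w(2) by (simp add: canonical_def)
  ultimately have "\<phi> \<in> w"
    using assms(2-4) canonical_is_model w(1) unfolding consequence_def by blast
  then show False
    using w mcs_Neg[OF assms(1) w(2) assms(2)] by blast
qed

end

text \<open>Completeness uses only models over sets of formulas, where the canonical model lives;
  the second conjunct gives soundness for an arbitrary world type \<open>'w\<close>.\<close>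

theorem mainTheorem1:
  fixes L :: "('s, 'o, 'p) language"
    and s :: 's
    and \<phi> :: "('o, 'p) fm"
    and \<Phi> :: "('o, 'p) fm set"
  assumes "many_sorted_language L"
    and "s \<in> sorts L"
    and "\<phi> \<in> Form L s"
    and "\<Phi> \<subseteq> Form L s"
  shows "(derivable_K L s \<Phi> \<phi> \<longleftrightarrow> consequence TYPE(('o, 'p) fm set) L s \<Phi> \<phi>) \<and>
         (derivable_K L s \<Phi> \<phi> \<longrightarrow> consequence TYPE('w) L s \<Phi> \<phi>)"
  by (intro conjI iffI impI; (rule derivable_K_sound | rule derivable_K_complete[OF assms]))

end
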